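(* Let $h,k\in\mathbb{C}$ with $k\ne0$. For all $y\in\mathbb{R}$, $$L^{(y)}(\mu(h,k))=\mu(h+y,k).$$
   Context: For $h,k\in\mathbb{C}$, $k\neq0$, let $Q_n(x)\in\mathbb{C}[x]$ be the monic polynomials defined by $Q_{-1}=0$, $Q_0=1$, $Q_n(x)=(x-h)Q_{n-1}(x)-kQ_{n-2}(x)$ for $n\ge1$. By Favard's theorem there is a unique linear functional $\mathcal{V}:\mathbb{C}[x]\to\mathbb{C}$ with $\mathcal{V}[1]=1$ and $\mathcal{V}[Q_mQ_n]=0$ for $m\ne n$. The moment sequence is $\mu(h,k)=\{\mu_n(h,k)\}_{n\ge0}$ with $\mu_n(h,k)=\mathcal{V}[x^n]$. The interpolated Binomial operator $L^{(y)}$ sends a sequence $\{a_n\}_{n\ge0}$ to $\{l_n\}_{n\ge0}$ with $l_n=\sum_{j=0}^n\binom{n}{j}y^{n-j}a_j$. *)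

theory Defs
  imports Complex_Main "HOL-Computational_Algebra.Polynomial"
begin

text \<open>The initial values \<open>Q\<^sub>-\<^sub>1 = 0\<close> and \<open>Q\<^sub>0 = 1\<close> turn the case \<open>n = 1\<close> of the recurrence
  into \<open>Q\<^sub>1 = x - h\<close>, so the recursion can be run on the natural numbers.\<close>

fun Q :: "complex \<Rightarrow> complex \<Rightarrow> nat \<Rightarrow> complex poly" where
  "Q h k 0 = 1"
| "Q h k (Suc 0) = [:- h, 1:]"
| "Q h k (Suc (Suc n)) = [:- h, 1:] * Q h k (Suc n) - smult k (Q h k n)"

text \<open>\<open>\<complex>\<close>-linearity is expressed with \<open>Vector_Spaces.linear\<close>, the scalar
  multiplications being those of \<open>\<complex>[x]\<close> and \<open>\<complex>\<close>.\<close>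

definition is_moment_functional ::
    "complex \<Rightarrow> complex \<Rightarrow> (complex poly \<Rightarrow> complex) \<Rightarrow> bool" where
  "is_moment_functional h k V \<longleftrightarrow>
     Vector_Spaces.linear smult (*) V \<and> V 1 = 1 \<and>
     (\<forall>m n. m \<noteq> n \<longrightarrow> V (Q h k m * Q h k n) = 0)"

text \<open>The description is meaningful by Favard's theorem: there is exactly one such functional.\<close>

definition moment_functional :: "complex \<Rightarrow> complex \<Rightarrow> complex poly \<Rightarrow> complex" where
  "moment_functional h k = (THE V. is_moment_functional h k V)"

definition moment :: "complex \<Rightarrow> complex \<Rightarrow> nat \<Rightarrow> complex" where
  "moment h k n = moment_functional h k ([:0, 1:] ^ n)"

definition interp_binomial :: "real \<Rightarrow> (nat \<Rightarrow> complex) \<Rightarrow> nat \<Rightarrow> complex" where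
  "interp_binomial y a n = (\<Sum>j\<le>n. of_nat (n choose j) * of_real y ^ (n - j) * a j)"

end

theory Submission
  imports Defs
begin

text \<open>The idea is that raising \<open>h\<close> by \<open>y\<close> merely translates the orthogonal polynomials:
  \<open>Q\<^sub>n\<close> for \<open>h + y\<close> is \<open>Q\<^sub>n(x - y)\<close> for \<open>h\<close> (lemma \<open>Q_shift\<close>), because \<open>h\<close> enters the recurrence
  only through \<open>x - h\<close>. Substitution is a ring homomorphism, so if \<open>V\<close> is a moment functional
  for \<open>h\<close>, then \<open>p \<mapsto> V (p (x + y))\<close> is one for \<open>h + y\<close>. Its \<open>n\<close>-th moment is \<open>V ((x + y)\<^sup>n)\<close>, and
  the binomial theorem turns this into the interpolated binomial transform of the moments of \<open>V\<close>.

  Since \<open>moment_functional\<close> is a definite description, this argument speaks about it only once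
  Favard's theorem is available for these polynomials. Uniqueness holds because the \<open>Q\<^sub>n\<close> are
  monic of degree \<open>n\<close>, hence span all polynomials, and because orthogonality to \<open>Q\<^sub>0 = 1\<close> forces
  \<open>V Q\<^sub>n = 0\<close> for \<open>n > 0\<close>. For existence, multiplication by \<open>x\<close> is written in the basis \<open>(Q\<^sub>n)\<close>
  as a tridiagonal (Jacobi) operator; this yields the coordinates of a polynomial in that basis,
  and \<open>V\<close> is the coordinate at \<open>Q\<^sub>0\<close>. Orthogonality then follows from the recurrence, since
  multiplication by \<open>x\<close> lowers the index of \<open>Q\<^sub>n\<close> by at most one.\<close>

section \<open>The orthogonal polynomials\<close>

lemma X_times_Q:
  "[:0, 1:] * Q h k (Suc n) = Q h k (Suc (Suc n)) + smult h (Q h k (Suc n)) + smult k (Q h k n)"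
  by simp

lemma degree_Q: "degree (Q h k n) = n"
  and lead_coeff_Q: "coeff (Q h k n) n = 1"
proof -
  have "degree (Q h k n) = n \<and> coeff (Q h k n) n = 1"
  proof (induction h k n rule: Q.induct)
    case (3 h k n)
    let ?A = "[:- h, 1:] * Q h k (Suc n)" and ?B = "smult k (Q h k n)"
    have nz: "Q h k (Suc n) \<noteq> 0"
      using "3.IH"(1) by auto
    have dA: "degree ?A = Suc (Suc n)"
      using nz "3.IH"(1) by (subst degree_mult_eq) auto
    have dB: "degree ?B < Suc (Suc n)"
      using degree_smult_le[of k "Q h k n"] "3.IH"(2) by simp
    have cA: "coeff ?A (Suc (Suc n)) = 1"
      using "3.IH"(1) by (simp add: coeff_eq_0)
    have "degree (?A - ?B) = Suc (Suc n)"
      using degree_add_eq_left[of "- ?B" ?A] dA dB by simp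
    moreover have "coeff (?A - ?B) (Suc (Suc n)) = 1"
      using cA dB by (simp only: coeff_diff coeff_eq_0) simp
    ultimately show ?case by simp
  qed auto
  then show "degree (Q h k n) = n" "coeff (Q h k n) n = 1" by auto
qed

lemma Q_shift: "Q (h + c) k n = pcompose (Q h k n) [:- c, 1:]"
proof (induction h k n rule: Q.induct)
  case (3 h k n)
  have "pcompose [:- h, 1:] [:- c, 1:] = [:- (h + c), 1:]"
    by (simp add: pcompose_pCons)
  with 3 show ?case
    by (simp only: Q.simps pcompose_diff pcompose_mult pcompose_smult)
qed (auto simp: pcompose_pCons pcompose_1)

section \<open>Linear functionals on polynomials\<close>

lemma linear_functional_iff:
  fixes V :: "complex poly \<Rightarrow> complex"
  shows "Vector_Spaces.linear smult (*) V \<longleftrightarrow>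
    (\<forall>p q. V (p + q) = V p + V q) \<and> (\<forall>c p. V (smult c p) = c * V p)"
proof -
  have "vector_space (smult :: complex \<Rightarrow> _)" "vector_space ((*) :: complex \<Rightarrow> _)"
    by (unfold_locales; simp add: algebra_simps smult_add_right smult_add_left)+
  then show ?thesis
    by (auto simp: Vector_Spaces.linear_iff)
qed

context
  fixes V :: "complex poly \<Rightarrow> complex"
  assumes lin: "Vector_Spaces.linear smult (*) V"
begin

lemma functional_add: "V (p + q) = V p + V q"
  using lin by (simp add: linear_functional_iff)

lemma functional_smult: "V (smult c p) = c * V p"
  using lin by (simp add: linear_functional_iff)

lemma functional_0: "V 0 = 0"
  using functional_smult[of 0 0] by simp

lemma functional_sum: "V (\<Sum>i\<in>A. f i) = (\<Sum>i\<in>A. V (f i))"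
  by (induction A rule: infinite_finite_induct) (auto simp: functional_0 functional_add)

text \<open>Orthogonality is derived from the values on the basis alone. Expanding \<open>x Q\<^sub>n\<close> by the
  recurrence trades one factor \<open>x\<close> for indices at least \<open>n - 1\<close>, so fewer than \<open>n\<close> factors never
  reach \<open>Q\<^sub>0\<close>.\<close>

lemma power_Q_eq_0:
  assumes V_Q: "\<And>n. n > 0 \<Longrightarrow> V (Q h k n) = 0"
  shows "j < n \<Longrightarrow> V ([:0, 1:] ^ j * Q h k n) = 0"
proof (induction j arbitrary: n)
  case 0
  then show ?case using V_Q by simp
next
  case (Suc j)
  then obtain m where m: "n = Suc m" "j < m" by (cases n) auto
  have "[:0, 1:] ^ Suc j * Q h k n = [:0, 1:] ^ j * ([:0, 1:] * Q h k (Suc m))"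
    by (simp only: m power_Suc mult_ac)
  also have "\<dots> = [:0, 1:] ^ j * Q h k (Suc (Suc m))
      + smult h ([:0, 1:] ^ j * Q h k (Suc m)) + smult k ([:0, 1:] ^ j * Q h k m)"
    unfolding X_times_Q by (simp only: distrib_left mult_smult_right)
  finally show ?case
    using m Suc.IH[of "Suc (Suc m)"] Suc.IH[of "Suc m"] Suc.IH[of m]
    by (simp only: functional_add functional_smult) simp
qed

lemma lower_degree_Q_eq_0:
  assumes V_Q: "\<And>n. n > 0 \<Longrightarrow> V (Q h k n) = 0"
    and "degree p < n"
  shows "V (p * Q h k n) = 0"
proof -
  have "p * Q h k n = (\<Sum>i\<le>degree p. smult (coeff p i) ([:0, 1:] ^ i * Q h k n))"
    by (subst (1) poly_as_sum_of_monoms[of p, symmetric])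
       (simp add: sum_distrib_right monom_altdef)
  then show ?thesis
    using power_Q_eq_0[OF V_Q] assms(2) by (simp add: functional_sum functional_smult)
qed

lemma is_moment_functionalI:
  assumes "V 1 = 1" and V_Q: "\<And>n. n > 0 \<Longrightarrow> V (Q h k n) = 0"
  shows "is_moment_functional h k V"
  unfolding is_moment_functional_def
proof (intro conjI allI impI)
  fix m n :: nat
  assume "m \<noteq> n"
  then consider "m < n" | "n < m" by linarith
  then show "V (Q h k m * Q h k n) = 0"
  proof cases
    case 1
    then show ?thesis using lower_degree_Q_eq_0[OF V_Q, of "Q h k m"] by (simp add: degree_Q)
  next
    case 2
    then show ?thesis using lower_degree_Q_eq_0[OF V_Q, of "Q h k n"]
      by (simp add: degree_Q mult.commute)
  qed
qed (use lin assms in auto)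

end

section \<open>Existence of the moment functional\<close>

text \<open>Here a polynomial serves as a coordinate vector, its coefficient at \<open>n\<close> being the coordinate
  at \<open>Q\<^sub>n\<close>. In these coordinates multiplication by \<open>x\<close> sends \<open>e\<^sub>n\<close> to
  \<open>e\<^sub>n\<^sub>+\<^sub>1 + h e\<^sub>n + k e\<^sub>n\<^sub>-\<^sub>1\<close>, with \<open>e\<^sub>-\<^sub>1 = 0\<close>.\<close>

definition jacobi :: "complex \<Rightarrow> complex \<Rightarrow> complex poly \<Rightarrow> complex poly" where
  "jacobi h k p = pCons 0 p + smult h p + smult k (poly_shift 1 p)"

lemma jacobi_add: "jacobi h k (p + q) = jacobi h k p + jacobi h k q"
  by (rule poly_eqI)
     (simp add: jacobi_def coeff_poly_shift coeff_pCons algebra_simps split: nat.split)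

lemma jacobi_smult: "jacobi h k (smult c p) = smult c (jacobi h k p)"
  by (rule poly_eqI)
     (simp add: jacobi_def coeff_poly_shift coeff_pCons algebra_simps split: nat.split)

lemma jacobi_0: "jacobi h k 0 = 0"
  using jacobi_smult[of h k 0 0] by simp

text \<open>Horner's scheme for evaluating a polynomial at the Jacobi operator and applying the result
  to \<open>e\<^sub>0 = 1\<close>.\<close>

definition Q_coords :: "complex \<Rightarrow> complex \<Rightarrow> complex poly \<Rightarrow> complex poly" where
  "Q_coords h k p = fold_coeffs (\<lambda>a r. [:a:] + jacobi h k r) p 0"

lemma Q_coords_0: "Q_coords h k 0 = 0"
  by (simp add: Q_coords_def)

text \<open>No step of the fold is taken for the trailing zero in \<open>pCons 0 0\<close>; the equation holds there
  because the Jacobi operator maps \<open>0\<close> to \<open>0\<close>.\<close>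

lemma Q_coords_pCons: "Q_coords h k (pCons a p) = [:a:] + jacobi h k (Q_coords h k p)"
  by (cases "p = 0 \<and> a = 0") (auto simp: Q_coords_def jacobi_0)

lemma Q_coords_add: "Q_coords h k (p + q) = Q_coords h k p + Q_coords h k q"
  by (induction p q rule: poly_induct2) (simp_all add: Q_coords_0 Q_coords_pCons jacobi_add)

lemma Q_coords_smult: "Q_coords h k (smult c p) = smult c (Q_coords h k p)"
  by (induction p) (simp_all add: Q_coords_0 Q_coords_pCons jacobi_smult smult_add_right)

lemma Q_coords_diff: "Q_coords h k (p - q) = Q_coords h k p - Q_coords h k q"
  using Q_coords_add[of h k p "smult (- 1) q"] Q_coords_smult[of h k "- 1" q] by simp

lemma Q_coords_Q: "Q_coords h k (Q h k n) = monom 1 n"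
proof (induction h k n rule: Q.induct)
  case (1 h k)
  then show ?case by (simp add: one_pCons Q_coords_pCons Q_coords_0 jacobi_0 monom_0)
next
  case (2 h k)
  show ?case
    by (rule poly_eqI) (simp add: Q_coords_pCons Q_coords_0 jacobi_0 jacobi_def
        coeff_poly_shift coeff_pCons split: nat.split)
next
  case (3 h k n)
  have "Q h k (Suc (Suc n)) =
      pCons 0 (Q h k (Suc n)) - smult h (Q h k (Suc n)) - smult k (Q h k n)"
    by simp
  then have "Q_coords h k (Q h k (Suc (Suc n))) =
      jacobi h k (monom 1 (Suc n)) - smult h (monom 1 (Suc n)) - smult k (monom 1 n)"
    using 3 by (simp only: Q_coords_diff Q_coords_smult Q_coords_pCons) simp
  also have "\<dots> = monom 1 (Suc (Suc n))"
    by (rule poly_eqI)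
       (auto simp: jacobi_def coeff_poly_shift coeff_pCons coeff_monom split: nat.split)
  finally show ?case .
qed

lemma moment_functional_exists: "\<exists>V. is_moment_functional h k V"
proof
  let ?V = "\<lambda>p. coeff (Q_coords h k p) 0"
  have V_Q: "?V (Q h k n) = (if n = 0 then 1 else 0)" for n
    by (simp add: Q_coords_Q)
  have "Vector_Spaces.linear smult (*) ?V"
    by (simp add: linear_functional_iff Q_coords_add Q_coords_smult)
  then show "is_moment_functional h k ?V"
    using V_Q[of 0] V_Q by (intro is_moment_functionalI) auto
qed

section \<open>Uniqueness of the moment functional\<close>

text \<open>Subtracting a multiple of \<open>Q\<^sub>n\<close> cancels the leading term, so the values on the \<open>Q\<^sub>n\<close>
  determine a linear functional.\<close>

lemma functional_eqI:
  assumes V: "Vector_Spaces.linear smult (*) V" and W: "Vector_Spaces.linear smult (*) W"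
    and eq: "\<And>n. V (Q h k n) = W (Q h k n)"
  shows "V p = W p"
proof (induction "degree p" arbitrary: p rule: less_induct)
  case less
  define n where "n = degree p"
  define r where "r = p - smult (coeff p n) (Q h k n)"
  have p: "p = r + smult (coeff p n) (Q h k n)"
    by (simp add: r_def)
  have "V r = W r"
  proof (cases "n = 0")
    case True
    then have "r = 0"
      by (auto simp: r_def n_def elim!: degree_eq_zeroE)
    then show ?thesis by (simp add: functional_0[OF V] functional_0[OF W])
  next
    case False
    have "degree r \<le> n"
      using degree_smult_le[of "coeff p n" "Q h k n"]
      by (auto simp: r_def n_def degree_Q intro!: degree_diff_le)
    moreover have "coeff r n = 0"
      by (simp add: r_def lead_coeff_Q)
    ultimately have "degree r < degree p"
      using False eq_zero_or_degree_less[of r n] by (auto simp: n_def)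
    then show ?thesis by (rule less)
  qed
  then show ?case
    by (subst (1 2) p)
       (simp add: functional_add[OF V] functional_add[OF W]
          functional_smult[OF V] functional_smult[OF W] eq)
qed

lemma moment_functional_unique:
  assumes V: "is_moment_functional h k V" and W: "is_moment_functional h k W"
  shows "V = W"
proof
  fix p
  have on_Q: "U (Q h k n) = (if n = 0 then 1 else 0)" if "is_moment_functional h k U" for U n
  proof (cases n)
    case (Suc m)
    then have "U (Q h k 0 * Q h k n) = 0"
      using that unfolding is_moment_functional_def by blast
    then show ?thesis using Suc by simp
  qed (use that in \<open>simp add: is_moment_functional_def\<close>)
  have "Vector_Spaces.linear smult (*) V" "Vector_Spaces.linear smult (*) W"
    using V W unfolding is_moment_functional_def by blast+
  then show "V p = W p"
    by (rule functional_eqI[where h = h and k = k]) (simp only: on_Q[OF V] on_Q[OF W])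
qed

lemma moment_functional_eqI:
  "is_moment_functional h k V \<Longrightarrow> moment_functional h k = V"
  unfolding moment_functional_def by (rule the_equality) (auto intro: moment_functional_unique)

lemma is_moment_functional_moment_functional:
  "is_moment_functional h k (moment_functional h k)"
  using moment_functional_exists moment_functional_eqI by metis

section \<open>Translation of the moment functional\<close>

text \<open>Substituting \<open>x + c\<close> turns each \<open>Q\<^sub>n\<close> for \<open>h + c\<close> back into \<open>Q\<^sub>n\<close> for \<open>h\<close>, so orthogonality
  is inherited from \<open>V\<close>.\<close>

lemma is_moment_functional_shift:
  assumes "is_moment_functional h k V"
  shows "is_moment_functional (h + c) k (\<lambda>p. V (pcompose p [:c, 1:]))"
proof -
  have "pcompose [:- c, 1:] [:c, 1:] = [:0, 1:]"
    by (simp add: pcompose_pCons)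
  then have "pcompose (Q (h + c) k n) [:c, 1:] = Q h k n" for n
    by (simp only: Q_shift pcompose_assoc[symmetric] pcompose_idR)
  then show ?thesis
    using assms
    by (simp add: is_moment_functional_def linear_functional_iff pcompose_add pcompose_smult
        pcompose_mult pcompose_1)
qed

lemma pcompose_power: "pcompose (p ^ n) q = pcompose p q ^ n"
  by (induction n) (simp_all add: pcompose_1 pcompose_mult)

lemma moment_shift:
  "moment (h + c) k n = (\<Sum>j\<le>n. of_nat (n choose j) * c ^ (n - j) * moment h k j)"
proof -
  let ?V = "moment_functional h k"
  have lin: "Vector_Spaces.linear smult (*) ?V"
    using is_moment_functional_moment_functional by (simp add: is_moment_functional_def)
  have "pcompose [:0, 1:] [:c, 1:] = [:0, 1:] + [:c:]"
    by (simp add: pcompose_pCons)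
  then have "pcompose ([:0, 1:] ^ n) [:c, 1:] = ([:0, 1:] + [:c:]) ^ n"
    by (simp only: pcompose_power)
  also have "\<dots> = (\<Sum>j\<le>n. smult (of_nat (n choose j) * c ^ (n - j)) ([:0, 1:] ^ j))"
    unfolding binomial_ring
    by (intro sum.cong refl) (simp add: of_nat_poly poly_const_pow mult_ac)
  finally have expand: "pcompose ([:0, 1:] ^ n) [:c, 1:] =
      (\<Sum>j\<le>n. smult (of_nat (n choose j) * c ^ (n - j)) ([:0, 1:] ^ j))" .
  have "moment (h + c) k n = ?V (pcompose ([:0, 1:] ^ n) [:c, 1:])"
    by (simp only: moment_def
        moment_functional_eqI[OF is_moment_functional_shift[OF is_moment_functional_moment_functional]])
  also have "\<dots> = (\<Sum>j\<le>n. of_nat (n choose j) * c ^ (n - j) * moment h k j)"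
    unfolding expand functional_sum[OF lin] functional_smult[OF lin] moment_def ..
  finally show ?thesis .
qed

theorem corollary5p2:
  fixes h k :: complex and y :: real
  assumes "k \<noteq> 0"
  shows "interp_binomial y (moment h k) = moment (h + of_real y) k"
  by (rule ext) (simp add: interp_binomial_def moment_shift)

end
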